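(* (i) If $d \geq 5$ and $1 \leq p \leq \frac{d}{d-2}$, then the discrete spherical maximal operator $A_\star$ is not bounded on $\ell^p(\mathbb{Z}^d)$. (ii) If $2 \leq d \leq 4$, then $A_\star$ is not bounded on $\ell^p(\mathbb{Z}^d)$ for any $1 \leq p < \infty$.
   Context: For $\lambda>0$, let $N(\lambda)$ be the number of $m \in \mathbb{Z}^d$ with $|m| = \lambda$, where $|\cdot|$ is the Euclidean norm. For $\lambda$ with $N(\lambda)>0$ (so $\lambda^2$ is an integer) and $f : \mathbb{Z}^d \to \mathbb{C}$ define $$A_\lambda(f)(n) = \frac{1}{N(\lambda)} \sum_{m \in \mathbb{Z}^d,\ |m| = \lambda} f(n-m), \qquad n \in \mathbb{Z}^d,$$ and $A_\star(f)(n) = \sup_{\lambda} |A_\lambda(f)(n)|$, the supremum being over all $\lambda > 0$ with $N(\lambda) > 0$. "Bounded on $\ell^p$" means that $\|A_\star f\|_{\ell^p} \leq C\|f\|_{\ell^p}$ for some finite $C$ and all $f \in \ell^p(\mathbb{Z}^d)$. *)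

theory Defs
  imports "HOL-Analysis.Analysis"
begin

text \<open>The lattice \<open>\<int>\<^sup>d\<close> is the type \<^typ>\<open>int ^ 'd\<close> with \<open>d = CARD('d)\<close>; its
  Euclidean norm is the norm of the image in \<^typ>\<open>real ^ 'd\<close>.\<close>

definition int_norm :: "int ^ 'd \<Rightarrow> real" where
  "int_norm m = norm (\<chi> i. real_of_int (m $ i))"

definition lattice_sphere :: "real \<Rightarrow> (int ^ 'd) set" where
  "lattice_sphere r = {m. int_norm m = r}"

definition radii :: "'d::finite itself \<Rightarrow> real set" where
  "radii _ = {r. r > 0 \<and> card (lattice_sphere r :: (int ^ 'd) set) > 0}"

definition sph_avg :: "real \<Rightarrow> (int ^ 'd \<Rightarrow> complex) \<Rightarrow> int ^ 'd \<Rightarrow> complex" where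
  "sph_avg r f n =
     (1 / of_nat (card (lattice_sphere r :: (int ^ 'd) set))) * (\<Sum>m\<in>lattice_sphere r. f (n - m))"

text \<open>The supremum is taken in the reals; it is a genuine least upper bound for every
  \<open>f \<in> \<ell>\<^sup>p\<close>, see \<open>bdd_above_sph_avg\<close> and \<open>radii_nonempty\<close> below.\<close>

definition sph_max :: "(int ^ 'd \<Rightarrow> complex) \<Rightarrow> int ^ 'd \<Rightarrow> real" where
  "sph_max f n = (SUP r\<in>radii TYPE('d). norm (sph_avg r f n))"

definition lp_space :: "real \<Rightarrow> ('a \<Rightarrow> 'b::real_normed_vector) set" where
  "lp_space p = {f. (\<lambda>n. norm (f n) powr p) summable_on UNIV}"

definition lp_norm :: "real \<Rightarrow> ('a \<Rightarrow> 'b::real_normed_vector) \<Rightarrow> real" where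
  "lp_norm p f = (\<Sum>\<^sub>\<infinity>n. norm (f n) powr p) powr (1 / p)"

text \<open>The membership \<open>T f \<in> lp_space p\<close> says that the norm of \<open>T f\<close> is finite: \<^const>\<open>infsum\<close>
  is \<open>0\<close> on families that are not summable, so the inequality alone would not.\<close>

definition bounded_on_lp ::
  "real \<Rightarrow> (('a \<Rightarrow> 'b::real_normed_vector) \<Rightarrow> 'a \<Rightarrow> 'c::real_normed_vector) \<Rightarrow> bool" where
  "bounded_on_lp p T \<longleftrightarrow>
     (\<exists>C. \<forall>f\<in>lp_space p. T f \<in> lp_space p \<and> lp_norm p (T f) \<le> C * lp_norm p f)"

lemma finite_lattice_sphere: "finite (lattice_sphere r :: (int ^ 'd) set)"
proof -
  let ?B = "{- \<lceil>r\<rceil>..\<lceil>r\<rceil>}"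
  have "lattice_sphere r \<subseteq> (vec_lambda ` (UNIV \<rightarrow>\<^sub>E ?B) :: (int ^ 'd) set)"
  proof
    fix m :: "int ^ 'd" assume "m \<in> lattice_sphere r"
    then have r: "norm (\<chi> i. real_of_int (m $ i)) = r"
      by (simp add: lattice_sphere_def int_norm_def)
    have "m $ i \<in> ?B" for i
    proof -
      have "\<bar>real_of_int (m $ i)\<bar> \<le> r"
        using component_le_norm_cart[of "\<chi> i. real_of_int (m $ i)" i] r by simp
      then show ?thesis by (simp add: abs_le_iff) linarith
    qed
    then have "vec_nth m \<in> UNIV \<rightarrow>\<^sub>E ?B" by auto
    then show "m \<in> vec_lambda ` (UNIV \<rightarrow>\<^sub>E ?B)"
      by (intro image_eqI[of _ _ "vec_nth m"]) (simp_all add: vec_nth_inverse)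
  qed
  then show ?thesis
    by (rule finite_subset) (intro finite_imageI finite_PiE; simp)
qed

lemma radii_nonempty: "radii TYPE('d::finite) \<noteq> {}"
proof -
  fix k :: 'd
  have "int_norm (axis k 1 :: int ^ 'd) = norm (axis k 1 :: real ^ 'd)"
    unfolding int_norm_def by (rule arg_cong[of _ _ norm]) (simp add: vec_eq_iff axis_def)
  then have "axis k 1 \<in> (lattice_sphere 1 :: (int ^ 'd) set)"
    by (simp add: lattice_sphere_def)
  then have "card (lattice_sphere 1 :: (int ^ 'd) set) > 0"
    using finite_lattice_sphere card_gt_0_iff by blast
  then have "1 \<in> radii TYPE('d)" by (simp add: radii_def)
  then show ?thesis by blast
qed

lemma bdd_above_sph_avg:
  fixes f :: "int ^ 'd \<Rightarrow> complex"
  assumes p: "p > 0" and f: "f \<in> lp_space p"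
  shows "bdd_above ((\<lambda>r. norm (sph_avg r f n)) ` radii TYPE('d))"
proof -
  define S where "S = (\<Sum>\<^sub>\<infinity>n. norm (f n) powr p)"
  define B where "B = S powr (1 / p)"
  have le: "norm (f k) \<le> B" for k
  proof -
    have "(\<Sum>\<^sub>\<infinity>n\<in>{k}. norm (f n) powr p) \<le> S"
      unfolding S_def using f by (intro infsum_mono_neutral) (auto simp: lp_space_def)
    then have "(norm (f k) powr p) powr (1 / p) \<le> B"
      unfolding B_def using p by (intro powr_mono2) auto
    then show ?thesis using p by (simp add: powr_powr)
  qed
  have "norm (sph_avg r f n) \<le> B" if r: "r \<in> radii TYPE('d)" for r
  proof -
    define N where "N = card (lattice_sphere r :: (int ^ 'd) set)"
    have N: "N > 0" using r by (simp add: radii_def N_def)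
    have "norm (\<Sum>m\<in>lattice_sphere r. f (n - m)) \<le> of_nat N * B"
      unfolding N_def by (intro sum_norm_bound le)
    then show ?thesis
      using N by (simp add: sph_avg_def norm_mult norm_divide flip: N_def)
        (simp add: field_simps)
  qed
  then show ?thesis by (intro bdd_aboveI2)
qed

end

(* The maximal function of the point mass at 0 is at least 1 / r(k) at every lattice point n
   with |n|^2 = k > 0, where r(k) counts these points, so l^p boundedness would force the series
   of r(k)^(1-p) over all k > 0 with r(k) > 0 to converge.  It diverges, because each annulus
   4^j <= k < 4^(j+1) contributes at least a fixed positive amount.

   In dimension at most 4, a sum of squares divisible by 8 has only even terms, so doubling is a
   bijection between the relevant spheres and r(4^j) does not depend on j >= 1.

   In dimension at least 5, the four-square theorem gives r(k) > 0 for all k.  The annulus contains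
   O(2^(jd)) lattice points, so at least 4^j of its shells satisfy r(k) <= C 2^(j(d-2)), and
   4^j 2^(-j(d-2)(p-1)) >= 1 exactly when p <= d/(d-2). *)

theory Submission
  imports Defs "HOL-Computational_Algebra.Primes"
begin

subsection \<open>Lagrange's four-square theorem\<close>

text \<open>Over the integers rather than the naturals, because the descent produces signed residues
  and differences.\<close>

definition sum4sq :: "int \<Rightarrow> bool" where
  "sum4sq n \<longleftrightarrow> (\<exists>a b c d. n = a\<^sup>2 + b\<^sup>2 + c\<^sup>2 + d\<^sup>2)"

text \<open>Multiplicativity of the quaternion norm, for one quaternion times the conjugate of
  another. The conjugate turns the first square into an inner product and the others into
  antisymmetric forms, which the descent exploits.\<close>

lemma euler_four_square:
  fixes a b c d x y z w :: "'a::comm_ring_1"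
  shows "(a\<^sup>2 + b\<^sup>2 + c\<^sup>2 + d\<^sup>2) * (x\<^sup>2 + y\<^sup>2 + z\<^sup>2 + w\<^sup>2) =
    (a*x + b*y + c*z + d*w)\<^sup>2 + (a*y - b*x + c*w - d*z)\<^sup>2 +
    (a*z - c*x + d*y - b*w)\<^sup>2 + (a*w - d*x + b*z - c*y)\<^sup>2"
  by (simp add: power2_eq_square algebra_simps)

lemma sum4sq_mult: "sum4sq m \<Longrightarrow> sum4sq n \<Longrightarrow> sum4sq (m * n)"
  unfolding sum4sq_def by (metis euler_four_square)

text \<open>Pigeonhole: for arguments from 0 to h, the squares and the numbers -1 - y^2 each give h
  + 1 distinct residues, together p + 1 > p, so some residue is shared. Distinctness holds because p
  would divide (x - y) * (x + y), whose factors are below p in absolute value.\<close>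

lemma prime_dvd_two_squares_plus_one:
  fixes p h :: int
  assumes p: "prime p" and h: "p = 2 * h + 1"
  obtains x y where "0 \<le> x" "x \<le> h" "0 \<le> y" "y \<le> h" "p dvd x\<^sup>2 + y\<^sup>2 + 1"
proof -
  have h1: "h \<ge> 1" using prime_ge_2_int[OF p] h by linarith
  have sq: "x = y" if "x \<in> {0..h}" "y \<in> {0..h}" "p dvd x\<^sup>2 - y\<^sup>2" for x y
  proof -
    have "p dvd (x - y) * (x + y)" using that(3) by (simp add: power2_eq_square algebra_simps)
    then consider "p dvd x - y" | "p dvd x + y" using p by (metis prime_dvd_mult_iff)
    then show ?thesis
    proof cases
      case 1
      then show ?thesis using that(1,2) h dvd_imp_le_int[of "x - y" p] by (cases "x = y") auto
    next
      case 2
      then show ?thesis using that(1,2) h dvd_imp_le_int[of "x + y" p] by (cases "x + y = 0") auto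
    qed
  qed
  let ?f = "\<lambda>x. x\<^sup>2 mod p" and ?g = "\<lambda>y. (- 1 - y\<^sup>2) mod p"
  have f: "inj_on ?f {0..h}"
    by (intro inj_onI sq) (auto simp: mod_eq_dvd_iff)
  have g: "inj_on ?g {0..h}"
  proof (intro inj_onI)
    fix x y assume xy: "x \<in> {0..h}" "y \<in> {0..h}" and "?g x = ?g y"
    then have "p dvd (- 1 - x\<^sup>2) - (- 1 - y\<^sup>2)" by (simp only: mod_eq_dvd_iff)
    then have "p dvd y\<^sup>2 - x\<^sup>2" by (simp add: algebra_simps)
    then show "x = y" using sq xy by metis
  qed
  have "?f ` {0..h} \<inter> ?g ` {0..h} \<noteq> {}"
  proof
    assume e: "?f ` {0..h} \<inter> ?g ` {0..h} = {}"
    have sub: "?f ` {0..h} \<union> ?g ` {0..h} \<subseteq> {0..<p}"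
      using h h1 pos_mod_bound[of p] by (intro Un_least image_subsetI) simp_all
    have "card (?f ` {0..h} \<union> ?g ` {0..h}) = nat (h + 1) + nat (h + 1)"
      using e f g by (subst card_Un_disjoint) (auto simp: card_image)
    moreover have "card (?f ` {0..h} \<union> ?g ` {0..h}) \<le> nat p"
      using card_mono[OF _ sub] by simp
    ultimately show False using h h1 by linarith
  qed
  then obtain x y where xy: "x \<in> {0..h}" "y \<in> {0..h}" "?f x = ?g y" by blast
  then have "p dvd x\<^sup>2 - (- 1 - y\<^sup>2)" by (simp only: mod_eq_dvd_iff)
  then show ?thesis using xy by (intro that[of x y]) (auto simp: algebra_simps)
qed

text \<open>The residue is taken in the half-open range -m/2 < y <= m/2, so the largest possible y^2
  is attained only at y = m/2. The descent has to exclude that extreme case.\<close>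

lemma least_absolute_residue:
  fixes x m :: int
  assumes "m > 0"
  obtains y c where "x = y + m * c" "4 * y\<^sup>2 \<le> m\<^sup>2" "4 * y\<^sup>2 = m\<^sup>2 \<Longrightarrow> 2 * y = m"
proof -
  define c where "c = (if 2 * (x mod m) \<le> m then x div m else x div m + 1)"
  define y where "y = (if 2 * (x mod m) \<le> m then x mod m else x mod m - m)"
  have x: "x = m * (x div m) + x mod m" by simp
  have b: "0 \<le> x mod m" "x mod m < m" using assms by auto
  have "y = x mod m \<and> 2 * (x mod m) \<le> m \<or> y = x mod m - m \<and> m < 2 * (x mod m)"
    by (auto simp: y_def)
  then have y1: "- m < 2 * y" "2 * y \<le> m"
    using b assms by linarith+
  have xy: "x = y + m * c" unfolding y_def c_def using x by (auto simp: distrib_left)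
  have "(2 * y)\<^sup>2 \<le> m\<^sup>2" using y1 by (intro power2_le_iff_abs_le[THEN iffD2]) auto
  moreover have "2 * y = m" if "4 * y\<^sup>2 = m\<^sup>2"
  proof -
    have "(2 * y)\<^sup>2 = m\<^sup>2" using that by (simp add: power2_eq_square)
    then show ?thesis using y1 unfolding power2_eq_iff by linarith
  qed
  ultimately show ?thesis
    by (intro that[of y c]) (use xy in \<open>auto simp: power2_eq_square\<close>)
qed

text \<open>Lagrange's descent. Reducing the four roots modulo m gives squares with sum Y = m * r,
  where r <= m. Euler's identity writes (m * p) * Y as four squares of multiples of m, and dividing
  by m^2 represents r * p. The cases r = 0 and r = m would make m divide p.\<close>

lemma sum4sq_descent:
  fixes m p :: int
  assumes p: "prime p" and m: "1 < m" "m < p" and s: "sum4sq (m * p)"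
  obtains r where "0 < r" "r < m" "sum4sq (r * p)"
proof -
  have ndvd: "\<not> m dvd p"
    using p m unfolding prime_int_iff by (metis less_irrefl order.strict_implies_order order.strict_trans zero_less_one)
  obtain x1 x2 x3 x4 where x: "m * p = x1\<^sup>2 + x2\<^sup>2 + x3\<^sup>2 + x4\<^sup>2"
    using s by (auto simp: sum4sq_def)
  have m0: "m > 0" using m by simp
  obtain y1 c1 where 1: "x1 = y1 + m * c1" "4 * y1\<^sup>2 \<le> m\<^sup>2" "4 * y1\<^sup>2 = m\<^sup>2 \<Longrightarrow> 2 * y1 = m"
    using least_absolute_residue[OF m0] by blast
  obtain y2 c2 where 2: "x2 = y2 + m * c2" "4 * y2\<^sup>2 \<le> m\<^sup>2" "4 * y2\<^sup>2 = m\<^sup>2 \<Longrightarrow> 2 * y2 = m"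
    using least_absolute_residue[OF m0] by blast
  obtain y3 c3 where 3: "x3 = y3 + m * c3" "4 * y3\<^sup>2 \<le> m\<^sup>2" "4 * y3\<^sup>2 = m\<^sup>2 \<Longrightarrow> 2 * y3 = m"
    using least_absolute_residue[OF m0] by blast
  obtain y4 c4 where 4: "x4 = y4 + m * c4" "4 * y4\<^sup>2 \<le> m\<^sup>2" "4 * y4\<^sup>2 = m\<^sup>2 \<Longrightarrow> 2 * y4 = m"
    using least_absolute_residue[OF m0] by blast
  define Y where "Y = y1\<^sup>2 + y2\<^sup>2 + y3\<^sup>2 + y4\<^sup>2"
  \<comment> \<open>Expanding x = y + m * c in m * p leaves Y plus a multiple of m, so this r is Y /
    m.\<close>
  define r where "r = p - (2*(y1*c1 + y2*c2 + y3*c3 + y4*c4) + m*(c1\<^sup>2 + c2\<^sup>2 + c3\<^sup>2 + c4\<^sup>2))"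
  have Y: "Y = m * r"
    using x unfolding Y_def r_def 1(1) 2(1) 3(1) 4(1) by (simp add: power2_eq_square algebra_simps)
  have "Y \<ge> 0" by (simp add: Y_def)
  then have r0: "r \<ge> 0" using Y m0 by (simp add: zero_le_mult_iff)
  have Ym: "Y \<le> m\<^sup>2" using 1 2 3 4 unfolding Y_def by linarith
  then have rm: "r \<le> m" using Y m0 by (simp add: power2_eq_square)
  have "r \<noteq> 0"
  proof
    assume "r = 0"
    then have "Y = 0" using Y by simp
    then have "y1\<^sup>2 = 0 \<and> y2\<^sup>2 = 0 \<and> y3\<^sup>2 = 0 \<and> y4\<^sup>2 = 0"
      unfolding Y_def using zero_le_power2[of y1] zero_le_power2[of y2] zero_le_power2[of y3] zero_le_power2[of y4]
      by linarith
    then have "m dvd p" using \<open>r = 0\<close> unfolding r_def by (simp add: dvd_def)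
    then show False using ndvd by simp
  qed
  moreover have "r \<noteq> m"
  proof
    assume rm: "r = m"
    then have "Y = m\<^sup>2" using Y by (simp add: power2_eq_square)
    then have "4 * y1\<^sup>2 = m\<^sup>2 \<and> 4 * y2\<^sup>2 = m\<^sup>2 \<and> 4 * y3\<^sup>2 = m\<^sup>2 \<and> 4 * y4\<^sup>2 = m\<^sup>2"
      using 1(2) 2(2) 3(2) 4(2) unfolding Y_def by linarith
    then have e: "2 * y1 = m" "2 * y2 = m" "2 * y3 = m" "2 * y4 = m" using 1 2 3 4 by auto
    \<comment> \<open>Since each 2 * y equals m, the cross terms in r are multiples of m as
      well.\<close>
    have "2*(y1*c1 + y2*c2 + y3*c3 + y4*c4) = m * (c1 + c2 + c3 + c4)"
      unfolding distrib_left mult.assoc[symmetric] e ..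
    then have "p = m * (1 + (c1 + c2 + c3 + c4) + (c1\<^sup>2 + c2\<^sup>2 + c3\<^sup>2 + c4\<^sup>2))"
      using rm unfolding r_def by (simp add: algebra_simps)
    then show False using ndvd by simp
  qed
  moreover have "sum4sq (r * p)"
  proof -
    \<comment> \<open>With x = y + m * c, the inner product is Y plus a multiple of m, and each
      antisymmetric form vanishes on the pair (y, y), so m factors out of all four.\<close>
    define z1 where "z1 = r + c1*y1 + c2*y2 + c3*y3 + c4*y4"
    define z2 where "z2 = c1*y2 - c2*y1 + c3*y4 - c4*y3"
    define z3 where "z3 = c1*y3 - c3*y1 + c4*y2 - c2*y4"
    define z4 where "z4 = c1*y4 - c4*y1 + c2*y3 - c3*y2"
    have z1: "x1*y1 + x2*y2 + x3*y3 + x4*y4 = m * z1"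
      using Y unfolding 1(1) 2(1) 3(1) 4(1) z1_def Y_def by (simp add: power2_eq_square algebra_simps)
    have z2: "x1*y2 - x2*y1 + x3*y4 - x4*y3 = m * z2"
      unfolding 1(1) 2(1) 3(1) 4(1) z2_def by (simp add: algebra_simps)
    have z3: "x1*y3 - x3*y1 + x4*y2 - x2*y4 = m * z3"
      unfolding 1(1) 2(1) 3(1) 4(1) z3_def by (simp add: algebra_simps)
    have z4: "x1*y4 - x4*y1 + x2*y3 - x3*y2 = m * z4"
      unfolding 1(1) 2(1) 3(1) 4(1) z4_def by (simp add: algebra_simps)
    have "m\<^sup>2 * (r * p) = (m * p) * Y" unfolding Y by (simp add: power2_eq_square)
    also have "\<dots> = (m * z1)\<^sup>2 + (m * z2)\<^sup>2 + (m * z3)\<^sup>2 + (m * z4)\<^sup>2"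
      unfolding x Y_def euler_four_square z1 z2 z3 z4 ..
    also have "\<dots> = m\<^sup>2 * (z1\<^sup>2 + z2\<^sup>2 + z3\<^sup>2 + z4\<^sup>2)" by (simp add: power_mult_distrib algebra_simps)
    finally have "r * p = z1\<^sup>2 + z2\<^sup>2 + z3\<^sup>2 + z4\<^sup>2" using m0 by simp
    then show ?thesis unfolding sum4sq_def by blast
  qed
  ultimately show ?thesis using r0 rm by (intro that[of r]) auto
qed

text \<open>For odd p, some multiple m * p with 0 < m < p has the form x^2 + y^2 + 1^2 + 0^2; the
  descent then brings m down to 1.\<close>

lemma sum4sq_prime:
  fixes p :: int
  assumes p: "prime p"
  shows "sum4sq p"
proof (cases "even p")
  case True
  then have "p = 2" using p by (metis primes_dvd_imp_eq two_is_prime)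
  then have "p = 1\<^sup>2 + 1\<^sup>2 + 0\<^sup>2 + 0\<^sup>2" by simp
  then show ?thesis unfolding sum4sq_def by blast
next
  case False
  then obtain h where h: "p = 2 * h + 1" by (auto elim: oddE)
  obtain x y where xy: "0 \<le> x" "x \<le> h" "0 \<le> y" "y \<le> h" "p dvd x\<^sup>2 + y\<^sup>2 + 1"
    using prime_dvd_two_squares_plus_one[OF p h] .
  obtain m where m: "x\<^sup>2 + y\<^sup>2 + 1 = p * m" using xy(5) by (auto simp: dvd_def)
  have p0: "p > 1" using p prime_gt_1_int by blast
  have "p * m > 0" using m zero_le_power2[of x] zero_le_power2[of y] by linarith
  then have m0: "m > 0" using p0 by (simp add: zero_less_mult_iff)
  have "x\<^sup>2 \<le> h\<^sup>2" "y\<^sup>2 \<le> h\<^sup>2" using xy by (auto intro: power_mono)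
  \<comment> \<open>As x and y are at most h < p / 2, this keeps x^2 + y^2 + 1 below p^2 and so
    gives m < p.\<close>
  moreover have "2 * h\<^sup>2 + 1 < p * p"
  proof -
    have "0 < 2 * h\<^sup>2 + 4 * h" using p0 h by (intro add_nonneg_pos) auto
    then show ?thesis unfolding h by (simp add: power2_eq_square algebra_simps)
  qed
  ultimately have "p * m < p * p" using m by linarith
  then have mp: "m < p" using p0 by simp
  have "sum4sq (m * p)" unfolding sum4sq_def using m
    by (intro exI[of _ x] exI[of _ y] exI[of _ 1] exI[of _ 0]) (simp add: mult.commute)
  then show ?thesis using m0 mp
  proof (induction "nat m" arbitrary: m rule: less_induct)
    case less
    show ?case
    proof (cases "m = 1")
      case True
      then show ?thesis using less by simp
    next
      case False
      then have "1 < m" using less by simp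
      from sum4sq_descent[OF p this less.prems(3,1)] obtain r
        where r: "0 < r" "r < m" "sum4sq (r * p)" .
      then show ?thesis using less.hyps[of r] less.prems by auto
    qed
  qed
qed

theorem lagrange_four_square: "sum4sq (int n)"
proof (induction n rule: prime_divisors_induct)
  case zero
  have "int 0 = 0\<^sup>2 + 0\<^sup>2 + 0\<^sup>2 + 0\<^sup>2" by simp
  then show ?case unfolding sum4sq_def by blast
next
  case (unit n)
  then have "int n = 1\<^sup>2 + 0\<^sup>2 + 0\<^sup>2 + 0\<^sup>2" by simp
  then show ?case unfolding sum4sq_def by blast
next
  case (factor p n)
  then show ?case using sum4sq_mult[OF sum4sq_prime[of "int p"]] by simp
qed

subsection \<open>Shells of lattice points and the point mass\<close>

text \<open>Integer-valued, so that congruences modulo 8 apply and spheres can be indexed by natural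
  numbers.\<close>

definition sqnorm :: "int ^ 'd \<Rightarrow> int" where
  "sqnorm m = (\<Sum>i\<in>UNIV. (m $ i)\<^sup>2)"

definition shell :: "nat \<Rightarrow> (int ^ 'd) set" where
  "shell k = {m. sqnorm m = int k}"

lemma component_le_sqnorm: "(m $ i)\<^sup>2 \<le> sqnorm m"
  unfolding sqnorm_def by (intro member_le_sum) auto

lemma int_norm_eq_sqrt: "int_norm m = sqrt (of_int (sqnorm m))"
  by (simp add: int_norm_def norm_vec_def L2_set_def sqnorm_def)

lemma shell_eq_lattice_sphere: "shell k = lattice_sphere (sqrt (real k))"
  by (auto simp: shell_def lattice_sphere_def int_norm_eq_sqrt)

lemma finite_shell: "finite (shell k)"
  unfolding shell_eq_lattice_sphere by (rule finite_lattice_sphere)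

definition delta :: "int ^ 'd \<Rightarrow> complex" where
  "delta n = (if n = 0 then 1 else 0)"

lemma delta_lp: "delta \<in> lp_space p"
  unfolding lp_space_def mem_Collect_eq
  by (rule finite_nonzero_values_imp_summable_on, rule finite_subset[of _ "{0}"])
     (auto simp: delta_def)

text \<open>In the average over the sphere of radius sqrt k, the summand
  \<open>delta (n - m)\<close> survives only for m = n. The condition on k makes this radius
  positive, hence admissible.\<close>

lemma sph_max_delta_ge:
  fixes n :: "int ^ 'd"
  assumes n: "n \<in> shell k" and k: "k \<ge> 1"
  shows "1 / real (card (shell k :: (int ^ 'd) set)) \<le> sph_max delta n"
proof -
  let ?S = "lattice_sphere (sqrt (real k)) :: (int ^ 'd) set"
  have nS: "n \<in> ?S" using n by (simp add: shell_eq_lattice_sphere)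
  then have "card ?S > 0" using finite_lattice_sphere card_gt_0_iff by blast
  then have r: "sqrt (real k) \<in> radii TYPE('d)" using k by (simp add: radii_def)
  have "(\<Sum>m\<in>?S. delta (n - m)) = (\<Sum>m\<in>?S. if m = n then 1 else 0)"
    by (intro sum.cong) (auto simp: delta_def)
  also have "\<dots> = 1" using nS by (simp add: finite_lattice_sphere)
  finally have "norm (sph_avg (sqrt (real k)) delta n) = 1 / real (card ?S)"
    by (simp add: sph_avg_def norm_divide)
  \<comment> \<open>A real supremum dominates its terms only if they are bounded above;
    \<open>delta\<close> lies in every \<open>lp_space\<close>, so the exponent 1 serves
    here.\<close>
  moreover have "norm (sph_avg (sqrt (real k)) delta n) \<le> sph_max delta n"
    unfolding sph_max_def by (intro cSUP_upper r bdd_above_sph_avg[of 1] delta_lp) simp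
  ultimately show ?thesis by (simp add: shell_eq_lattice_sphere)
qed

text \<open>On a shell of N points the maximal function of \<open>delta\<close> is at least 1 / N,
  so its p-th powers there sum to at least N * N^(-p). Shells are disjoint, so the partial sums stay
  below the full sum of p-th powers of \<open>sph_max delta\<close>, which boundedness makes
  finite.\<close>

lemma bounded_imp_shell_sums_bounded:
  assumes b: "bounded_on_lp p (sph_max :: (int ^ 'd \<Rightarrow> complex) \<Rightarrow> int ^ 'd \<Rightarrow> real)"
    and p: "p \<ge> 1"
  shows "\<exists>B. \<forall>K. (\<Sum>k\<in>{1..<K}. real (card (shell k :: (int ^ 'd) set)) powr (1 - p)) \<le> B"
proof -
  define g where "g n = norm (sph_max delta n) powr p" for n :: "int ^ 'd"
  have "(sph_max delta :: int ^ 'd \<Rightarrow> real) \<in> lp_space p"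
    using b delta_lp unfolding bounded_on_lp_def by blast
  then have g: "g summable_on UNIV" by (simp add: lp_space_def g_def[abs_def])
  have shell_sum: "real (card (shell k :: (int ^ 'd) set)) powr (1 - p) \<le> (\<Sum>n\<in>shell k. g n)"
    if k: "k \<ge> 1" for k
  proof -
    define N where "N = real (card (shell k :: (int ^ 'd) set))"
    have "N powr (1 - p) = N * (1 / N) powr p"
    \<comment> \<open>An empty shell gives 0 on both sides, because
      \<open>0 powr x = 0\<close>.\<close>
    proof (cases "N = 0")
      case False
      then have "N > 0" by (simp add: N_def)
      then show ?thesis by (simp add: powr_diff powr_divide)
    qed simp
    also have "\<dots> = (\<Sum>n\<in>(shell k :: (int ^ 'd) set). (1 / N) powr p)" by (simp add: N_def)
    also have "\<dots> \<le> (\<Sum>n\<in>shell k. g n)"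
    proof (rule sum_mono)
      fix n :: "int ^ 'd" assume "n \<in> shell k"
      then have "1 / N \<le> norm (sph_max delta n)"
        using sph_max_delta_ge[OF _ k, of n] by (simp add: N_def)
      then show "(1 / N) powr p \<le> g n"
        unfolding g_def using p by (intro powr_mono2) (auto simp: N_def)
    qed
    finally show ?thesis by (simp add: N_def)
  qed
  have "(\<Sum>k\<in>{1..<K}. real (card (shell k :: (int ^ 'd) set)) powr (1 - p)) \<le> infsum g UNIV" for K
  proof -
    have "(\<Sum>k\<in>{1..<K}. real (card (shell k :: (int ^ 'd) set)) powr (1 - p))
        \<le> (\<Sum>k\<in>{1..<K}. \<Sum>n\<in>shell k. g n)"
      by (intro sum_mono shell_sum) simp
    also have "\<dots> = sum g (\<Union>k\<in>{1..<K}. shell k)"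
      by (intro sum.UNION_disjoint[symmetric]) (auto simp: finite_shell, auto simp: shell_def)
    also have "\<dots> \<le> infsum g UNIV"
      by (intro finite_sum_le_infsum g) (auto simp: finite_shell g_def)
    finally show ?thesis .
  qed
  then show ?thesis by blast
qed

text \<open>J annuli push the partial sums above J * c. The hypothesis begins at j = 1 because in
  low dimension the sizes of \<open>shell (4 ^ j)\<close> are compared only from
  \<open>shell 4\<close> on.\<close>

lemma not_bounded_if_dyadic_lower_bound:
  assumes p: "p \<ge> 1" and c: "c > 0"
    and lower: "\<And>j. j \<ge> 1 \<Longrightarrow>
      c \<le> (\<Sum>k\<in>{4 ^ j..<4 ^ Suc j}. real (card (shell k :: (int ^ 'd) set)) powr (1 - p))"
  shows "\<not> bounded_on_lp p (sph_max :: (int ^ 'd \<Rightarrow> complex) \<Rightarrow> int ^ 'd \<Rightarrow> real)"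
proof
  define a where "a k = real (card (shell k :: (int ^ 'd) set)) powr (1 - p)" for k
  assume "bounded_on_lp p (sph_max :: (int ^ 'd \<Rightarrow> complex) \<Rightarrow> int ^ 'd \<Rightarrow> real)"
  from bounded_imp_shell_sums_bounded[OF this p]
  obtain B where B: "\<And>K. sum a {1..<K} \<le> B" unfolding a_def by blast
  have J: "real J * c \<le> sum a {1..<4 ^ Suc J}" for J
  proof (induction J)
    case 0
    \<comment> \<open>The annulus j = 0, that is k from 1 to 3, enters only through
      nonnegativity.\<close>
    show ?case by (auto intro!: sum_nonneg simp: a_def)
  next
    case (Suc J)
    have "sum a {1..<4 ^ Suc (Suc J)} =
        sum a {1..<4 ^ Suc J} + sum a {4 ^ Suc J..<4 ^ Suc (Suc J)}"
      by (rule sum.atLeastLessThan_concat[symmetric]) simp_all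
    moreover have "c \<le> sum a {4 ^ Suc J..<4 ^ Suc (Suc J)}"
      unfolding a_def by (rule lower) simp
    ultimately show ?case using Suc by (simp add: algebra_simps del: power_Suc)
  qed
  obtain J :: nat where "B < real J * c" using c ex_less_of_nat_mult by blast
  then show False using J[of J] B[of "4 ^ Suc J"] by linarith
qed

section \<open>Dimension at most 4: doubling and congruences modulo 8\<close>

lemma odd_square_mod_8:
  fixes z :: int
  assumes "odd z"
  shows "8 dvd z\<^sup>2 - 1"
proof -
  obtain k where k: "z = 2 * k + 1" using assms by (auto elim: oddE)
  have "even (k * (k + 1))" by simp
  then obtain l where l: "k * (k + 1) = 2 * l" by (rule evenE)
  have "z\<^sup>2 - 1 = 4 * (k * (k + 1))" unfolding k by (simp add: power2_eq_square algebra_simps)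
  then show ?thesis unfolding l by simp
qed

text \<open>Odd squares are 1 modulo 8 and even squares 0 modulo 4, so the number of odd entries is
  divisible by 4. If it were 4, every entry would be odd and the sum would be 4 modulo 8.\<close>

lemma even_components:
  fixes m :: "int ^ 'd"
  assumes d: "CARD('d) \<le> 4" and m: "8 dvd sqnorm m"
  shows "even (m $ i)"
proof -
  define O' where "O' = {i. odd (m $ i)}"
  have split: "sqnorm m = (\<Sum>i\<in>O'. (m $ i)\<^sup>2 - 1) + int (card O') + (\<Sum>i\<in>- O'. (m $ i)\<^sup>2)"
  proof -
    have "sqnorm m = (\<Sum>i\<in>O'. (m $ i)\<^sup>2) + (\<Sum>i\<in>- O'. (m $ i)\<^sup>2)"
      unfolding sqnorm_def by (subst sum.union_disjoint[symmetric]) auto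
    then show ?thesis by (simp add: sum_subtractf)
  qed
  have 1: "8 dvd (\<Sum>i\<in>O'. (m $ i)\<^sup>2 - 1)"
    by (intro dvd_sum odd_square_mod_8) (simp add: O'_def)
  have 2: "4 dvd (\<Sum>i\<in>- O'. (m $ i)\<^sup>2)"
  proof (rule dvd_sum)
    fix i assume "i \<in> - O'"
    then have "2 dvd m $ i" by (simp add: O'_def)
    then have "2\<^sup>2 dvd (m $ i)\<^sup>2" by (rule dvd_power_same)
    then show "4 dvd (m $ i)\<^sup>2" by simp
  qed
  have "4 dvd int (card O')" using m 1 2 unfolding split by presburger
  then obtain q where q: "int (card O') = 4 * q" by (rule dvdE)
  have le: "card O' \<le> CARD('d)" by (intro card_mono) auto
  then have "q = 0 \<or> q = 1" using d q by linarith
  then consider "card O' = 0" | "card O' = 4" using q by fastforce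
  then show ?thesis
  proof cases
    case 1
    then show ?thesis by (auto simp: O'_def)
  next
    case 2
    then have "O' = UNIV" using d le by (intro card_eq_UNIV_imp_eq_UNIV) auto
    then have "- O' = {}" by auto
    then have "8 dvd (4::int)" using m 1 2 unfolding split by (simp add: dvd_add_right_iff)
    then show ?thesis by simp
  qed
qed

text \<open>Doubling is a bijection: 8 divides 4 * k, so every point of the larger shell has even
  entries and can be halved.\<close>

lemma card_shell_times_4:
  assumes d: "CARD('d) \<le> 4" and k: "even k"
  shows "card (shell (4 * k) :: (int ^ 'd) set) = card (shell k :: (int ^ 'd) set)"
proof -
  let ?f = "\<lambda>m :: int ^ 'd. \<chi> i. 2 * m $ i"
  have sq: "sqnorm (?f m) = 4 * sqnorm m" for m
    by (simp add: sqnorm_def power_mult_distrib sum_distrib_left)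
  have "bij_betw ?f (shell k) (shell (4 * k))"
  proof (intro bij_betw_imageI)
    show "inj_on ?f (shell k)" by (auto intro!: inj_onI simp: vec_eq_iff)
    show "?f ` shell k = shell (4 * k)"
    proof
      show "?f ` shell k \<subseteq> shell (4 * k)" by (auto simp: shell_def sq)
      show "shell (4 * k) \<subseteq> ?f ` shell k"
      proof
        fix m :: "int ^ 'd" assume m: "m \<in> shell (4 * k)"
        then have "sqnorm m = 4 * int k" by (simp add: shell_def)
        then have "8 dvd sqnorm m" using k by (elim evenE) simp
        then have "even (m $ i)" for i by (rule even_components[OF d])
        then have e: "m = ?f (\<chi> i. m $ i div 2)" by (simp add: vec_eq_iff)
        moreover have "(\<chi> i. m $ i div 2) \<in> shell k"
          using m sq[of "\<chi> i. m $ i div 2"] unfolding e[symmetric] by (simp add: shell_def)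
        ultimately show "m \<in> ?f ` shell k" by blast
      qed
    qed
  qed
  then show ?thesis by (rule bij_betw_same_card[symmetric])
qed

text \<open>The chain starts at \<open>shell 4\<close> because the doubling argument needs an even
  index, which 1 is not.\<close>

lemma card_shell_power_4:
  assumes d: "CARD('d) \<le> 4"
  shows "card (shell (4 ^ Suc j) :: (int ^ 'd) set) = card (shell 4 :: (int ^ 'd) set)"
proof (induction j)
  case (Suc j)
  have "card (shell (4 * 4 ^ Suc j) :: (int ^ 'd) set) = card (shell (4 ^ Suc j) :: (int ^ 'd) set)"
    by (rule card_shell_times_4[OF d]) simp
  then show ?case using Suc by simp
qed simp

text \<open>Makes the lower bound for the annuli positive, since an empty shell would give
  \<open>0 powr (1 - p) = 0\<close>.\<close>

lemma shell_4_nonempty: "(shell 4 :: (int ^ 'd::finite) set) \<noteq> {}"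
proof -
  fix i0 :: 'd
  define m :: "int ^ 'd" where "m = (\<chi> i. if i = i0 then 2 else 0)"
  have "sqnorm m = (\<Sum>i\<in>UNIV. if i = i0 then 4 else 0)"
    unfolding sqnorm_def m_def by (intro sum.cong) auto
  then have "m \<in> shell 4" by (simp add: shell_def)
  then show ?thesis by auto
qed

text \<open>Each annulus is bounded below by its single term at k = 4^j, whose value is the same for
  all j >= 1.\<close>

lemma not_bounded_low_dim:
  assumes d: "CARD('d::finite) \<le> 4" and p: "p \<ge> 1"
  shows "\<not> bounded_on_lp p (sph_max :: (int ^ 'd \<Rightarrow> complex) \<Rightarrow> int ^ 'd \<Rightarrow> real)"
proof (rule not_bounded_if_dyadic_lower_bound[OF p])
  let ?c = "real (card (shell 4 :: (int ^ 'd) set)) powr (1 - p)"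
  show "?c > 0" using shell_4_nonempty by (simp add: card_gt_0_iff finite_shell)
  fix j :: nat assume "j \<ge> 1"
  then obtain i where i: "j = Suc i" by (cases j) auto
  have "?c = real (card (shell (4 ^ j) :: (int ^ 'd) set)) powr (1 - p)"
    unfolding i card_shell_power_4[OF d] ..
  also have "\<dots> \<le> (\<Sum>k\<in>{4 ^ j..<4 ^ Suc j}. real (card (shell k :: (int ^ 'd) set)) powr (1 - p))"
    by (rule member_le_sum[of "4 ^ j"]) auto
  finally show "?c \<le> \<dots>" .
qed

section \<open>Dimension at least 5: counting lattice points in annuli\<close>

lemma sum_shells_le:
  "(\<Sum>k<(2 ^ j)\<^sup>2. card (shell k :: (int ^ 'd) set)) \<le> (2 ^ Suc j) ^ CARD('d::finite)"
proof -
  \<comment> \<open>A squared norm below (2^j)^2 forces every coordinate strictly between -2^j and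
    2^j; including the left end leaves exactly 2^(j+1) values.\<close>
  let ?I = "{- (2 ^ j)..<2 ^ j :: int}"
  have sub: "(\<Union>k<(2 ^ j)\<^sup>2. shell k) \<subseteq> (vec_lambda ` (UNIV \<rightarrow>\<^sub>E ?I) :: (int ^ 'd) set)"
  proof
    fix m :: "int ^ 'd" assume "m \<in> (\<Union>k<(2 ^ j)\<^sup>2. shell k)"
    then obtain k where k: "k < (2 ^ j)\<^sup>2" and m: "sqnorm m = int k" by (auto simp: shell_def)
    have "m $ i \<in> ?I" for i
    proof -
      have "(m $ i)\<^sup>2 \<le> int k" using component_le_sqnorm[of m i] m by simp
      also have "int k < int ((2 ^ j)\<^sup>2)" using k by (simp only: of_nat_less_iff)
      finally have "\<bar>m $ i\<bar>\<^sup>2 < (2 ^ j)\<^sup>2" by simp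
      then have "\<bar>m $ i\<bar> < 2 ^ j" by (rule power_less_imp_less_base) simp
      then show ?thesis by auto
    qed
    then have "vec_nth m \<in> UNIV \<rightarrow>\<^sub>E ?I" by auto
    then show "m \<in> vec_lambda ` (UNIV \<rightarrow>\<^sub>E ?I)"
      by (intro image_eqI[of _ _ "vec_nth m"]) (simp_all add: vec_nth_inverse)
  qed
  have "(\<Sum>k<(2 ^ j)\<^sup>2. card (shell k :: (int ^ 'd) set)) =
      card (\<Union>k<(2 ^ j)\<^sup>2. shell k :: (int ^ 'd) set)"
    by (intro card_UN_disjoint[symmetric]) (auto simp: finite_shell, auto simp: shell_def)
  also have "\<dots> \<le> card (vec_lambda ` (UNIV \<rightarrow>\<^sub>E ?I) :: (int ^ 'd) set)"
    by (intro card_mono sub finite_imageI finite_PiE) auto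
  also have "\<dots> \<le> card ((UNIV :: 'd set) \<rightarrow>\<^sub>E ?I)"
    by (intro card_image_le finite_PiE) auto
  also have "\<dots> = (2 ^ Suc j) ^ CARD('d)"
    by (simp add: card_PiE nat_mult_distrib nat_power_eq power_mult_distrib)
  finally show ?thesis .
qed

text \<open>Needed because an empty shell contributes nothing to the series. A four-square
  representation of k is placed on four distinct coordinates and padded with zeros.\<close>

lemma shell_nonempty:
  assumes "CARD('d::finite) \<ge> 4"
  shows "(shell k :: (int ^ 'd) set) \<noteq> {}"
proof -
  obtain a b c d where abcd: "int k = a\<^sup>2 + b\<^sup>2 + c\<^sup>2 + d\<^sup>2"
    using lagrange_four_square[of k] by (auto simp: sum4sq_def)
  obtain xs where xs: "set xs = (UNIV :: 'd set)" "distinct xs"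
    using finite_distinct_list[of "UNIV :: 'd set"] by auto
  have "length xs \<ge> 4" using assms xs distinct_card[of xs] by simp
  then obtain i1 i2 i3 i4 ys where "xs = i1 # i2 # i3 # i4 # ys"
    by (auto simp: numeral_eq_Suc Suc_le_length_iff)
  then have "distinct [i1, i2, i3, i4]" using xs by simp
  define m :: "int ^ 'd" where
    "m = (\<chi> i. if i = i1 then a else if i = i2 then b
      else if i = i3 then c else if i = i4 then d else 0)"
  have "sqnorm m = (\<Sum>i\<in>{i1, i2, i3, i4}. (m $ i)\<^sup>2)"
    unfolding sqnorm_def by (intro sum.mono_neutral_right) (auto simp: m_def)
  also have "\<dots> = int k" using \<open>distinct [i1, i2, i3, i4]\<close> abcd by (auto simp: m_def)
  finally show ?thesis by (auto simp: shell_def)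
qed

text \<open>Markov's inequality: the threshold is a bound for all lattice points in shells below
  4^(j+1), divided by 4^j, so at most 4^j of the 3 * 4^j shells in the annulus exceed it.\<close>

lemma many_small_shells:
  defines "N \<equiv> \<lambda>k. real (card (shell k :: (int ^ 'd::finite) set))"
  shows "4 ^ j \<le> card {k \<in> {4 ^ j..<4 ^ Suc j}. N k \<le> real ((2 ^ (j + 2)) ^ CARD('d)) / 4 ^ j}"
    (is "_ \<le> card ?G")
proof -
  let ?A = "{4 ^ j..<4 ^ Suc j :: nat}"
  define T where "T = real ((2 ^ (j + 2)) ^ CARD('d)) / 4 ^ j"
  define Bad where "Bad = {k \<in> ?A. N k > T}"
  have "T > 0" by (simp add: T_def)
  have four: "(4::nat) ^ Suc j = (2 ^ Suc j)\<^sup>2"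
    by (simp add: power2_eq_square flip: power_mult_distrib)
  have "real (card Bad) * T \<le> (\<Sum>k\<in>Bad. N k)"
    by (rule sum_bounded_below) (simp add: Bad_def)
  also have "\<dots> \<le> (\<Sum>k<4 ^ Suc j. N k)"
    by (intro sum_mono2) (auto simp: Bad_def N_def)
  also have "\<dots> = real (\<Sum>k<4 ^ Suc j. card (shell k :: (int ^ 'd) set))" by (simp add: N_def)
  also have "\<dots> \<le> real ((2 ^ (j + 2)) ^ CARD('d))"
    using sum_shells_le[where 'd = 'd, of "Suc j"] unfolding four of_nat_le_iff by simp
  also have "\<dots> = 4 ^ j * T" by (simp add: T_def)
  finally have "real (card Bad) \<le> 4 ^ j" using \<open>T > 0\<close> by simp
  then have bad: "card Bad \<le> 4 ^ j" by (simp flip: of_nat_le_iff)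
  have "?A = ?G \<union> Bad" by (auto simp: Bad_def T_def)
  then have "card ?A \<le> card ?G + card Bad" using card_Un_le by metis
  then show ?thesis using bad by simp
qed

lemma not_bounded_high_dim:
  assumes d: "CARD('d::finite) \<ge> 5" and p: "1 \<le> p" "p \<le> real CARD('d) / (real CARD('d) - 2)"
  shows "\<not> bounded_on_lp p (sph_max :: (int ^ 'd \<Rightarrow> complex) \<Rightarrow> int ^ 'd \<Rightarrow> real)"
proof (rule not_bounded_if_dyadic_lower_bound[OF p(1)])
  let ?d = "real CARD('d)"
  \<comment> \<open>The factor of \<open>4 ^ j * T powr (1 - p)\<close> that does not depend on
    j.\<close>
  let ?c = "2 powr (2 * ?d * (1 - p))"
  show "?c > 0" by simp
  fix j :: nat
  define N where "N k = real (card (shell k :: (int ^ 'd) set))" for k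
  define T where "T = real ((2 ^ (j + 2)) ^ CARD('d)) / 4 ^ j"
  define G where "G = {k \<in> {4 ^ j..<4 ^ Suc j}. N k \<le> T}"
  have "p * (?d - 2) \<le> ?d" using p d by (simp add: field_simps)
  \<comment> \<open>The critical exponent enters here: the second factor equals d - p * (d -
    2).\<close>
  then have "0 \<le> real j * (2 + (?d - 2) * (1 - p))"
    by (intro mult_nonneg_nonneg) (auto simp: algebra_simps)
  then have "?c \<le> 2 powr (2 * real j + ((real j + 2) * ?d - 2 * real j) * (1 - p))"
    by (intro powr_mono) (auto simp: algebra_simps)
  also have "\<dots> = 4 ^ j * T powr (1 - p)"
  proof -
    have four: "(4::real) ^ j = 2 powr (2 * real j)"
      by (simp add: powr_realpow[symmetric] powr_powr[symmetric])
    have "real ((2 ^ (j + 2)) ^ CARD('d)) = 2 ^ ((j + 2) * CARD('d))"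
      unfolding power_mult by simp
    also have "\<dots> = 2 powr ((real j + 2) * ?d)" by (simp add: powr_realpow[symmetric] algebra_simps)
    finally have "T = 2 powr ((real j + 2) * ?d - 2 * real j)"
      unfolding T_def four powr_diff by simp
    then show ?thesis unfolding four by (simp add: powr_powr powr_add)
  qed
  also have "\<dots> \<le> real (card G) * T powr (1 - p)"
    using many_small_shells[where 'd = 'd, of j] unfolding G_def N_def T_def
    by (intro mult_right_mono) (simp_all flip: of_nat_le_iff)
  also have "\<dots> \<le> (\<Sum>k\<in>G. N k powr (1 - p))"
  proof (rule sum_bounded_below)
    fix k assume "k \<in> G"
    \<comment> \<open>A power with nonpositive exponent is decreasing only on positive bases, so the
      four-square theorem is needed at this point.\<close>
    moreover have "N k > 0"
      using shell_nonempty[where 'd = 'd, of k] d by (simp add: N_def card_gt_0_iff finite_shell)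
    ultimately show "T powr (1 - p) \<le> N k powr (1 - p)"
      using p by (intro powr_mono2') (auto simp: G_def)
  qed
  also have "\<dots> \<le> (\<Sum>k\<in>{4 ^ j..<4 ^ Suc j}. N k powr (1 - p))"
    by (intro sum_mono2) (auto simp: G_def)
  finally show "?c \<le> (\<Sum>k\<in>{4 ^ j..<4 ^ Suc j}. real (card (shell k :: (int ^ 'd) set)) powr (1 - p))"
    unfolding N_def .
qed

theorem mainTheorem2:
  shows "(CARD('d::finite) \<ge> 5 \<longrightarrow>
           (\<forall>p::real. 1 \<le> p \<and> p \<le> real CARD('d) / (real CARD('d) - 2) \<longrightarrow>
             \<not> bounded_on_lp p (sph_max :: (int ^ 'd \<Rightarrow> complex) \<Rightarrow> int ^ 'd \<Rightarrow> real))) \<and>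
         (2 \<le> CARD('d) \<and> CARD('d) \<le> 4 \<longrightarrow>
           (\<forall>p::real. 1 \<le> p \<longrightarrow>
             \<not> bounded_on_lp p (sph_max :: (int ^ 'd \<Rightarrow> complex) \<Rightarrow> int ^ 'd \<Rightarrow> real)))"
proof (intro conjI impI allI)
  fix p :: real
  assume "5 \<le> CARD('d)" "1 \<le> p \<and> p \<le> real CARD('d) / (real CARD('d) - 2)"
  then show "\<not> bounded_on_lp p (sph_max :: (int ^ 'd \<Rightarrow> complex) \<Rightarrow> int ^ 'd \<Rightarrow> real)"
    by (intro not_bounded_high_dim) auto
next
  fix p :: real
  assume "2 \<le> CARD('d) \<and> CARD('d) \<le> 4" "1 \<le> p"
  then show "\<not> bounded_on_lp p (sph_max :: (int ^ 'd \<Rightarrow> complex) \<Rightarrow> int ^ 'd \<Rightarrow> real)"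
    by (intro not_bounded_low_dim) auto
qed

end
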